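(* Let $\boldsymbol{p}=(p_1,\ldots,p_k)$ be positive integers and let $\mathcal{X}\sim\mathcal{E}_{\boldsymbol{p}}(\boldsymbol{\mu},\boldsymbol{\Sigma},\psi)$ be a tensor elliptical random tensor of order $k$, with $\boldsymbol{\mu}\in\mathcal{T}^{\boldsymbol{p}}$ and $\boldsymbol{\Sigma}\in\mathcal{T}^{\boldsymbol{p}}_{\otimes}$. Then its characteristic function $\phi_{\mathcal{X}}(\boldsymbol{S})=E\left[e^{i\boldsymbol{S}'\boldsymbol{x}}\right]$, $\boldsymbol{x}=\operatorname{vec}\mathcal{X}$, has the form $$\phi_{\mathcal{X}}(\boldsymbol{S})=e^{i\boldsymbol{S}'\boldsymbol{\mu}}\,\psi(\boldsymbol{S}'\boldsymbol{\Sigma}\boldsymbol{S}),\qquad \boldsymbol{S}\in\mathcal{T}^{\boldsymbol{p}}.$$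
   Context: Notation. For $\boldsymbol{p}=(p_1,\ldots,p_k)$ put $p^*=\prod_{i=1}^k p_i$. A tensor $\mathcal{X}=(x_{i_1\cdots i_k})$, $1\le i_j\le p_j$, of order $k$ is identified with its vectorization $\operatorname{vec}\mathcal{X}=\sum x_{i_1\cdots i_k}\,\boldsymbol{e}^1_{i_1}\otimes\cdots\otimes\boldsymbol{e}^k_{i_k}$, where $\boldsymbol{e}^j_{i}$ is the $i$-th unit basis vector of $\mathbb{R}^{p_j}$ and $\otimes$ is the Kronecker product. $\mathcal{T}^{\boldsymbol{p}}$ is the space of all such vectors (so $\mathcal{T}^{\boldsymbol{p}}\cong\mathbb{R}^{p^*}$). $\mathcal{T}^{\boldsymbol{p}}_{\otimes}$ is the set of $p^*\times p^*$ matrices of the form $\boldsymbol{X}_1\otimes\cdots\otimes\boldsymbol{X}_k$ with $\boldsymbol{X}_i$ of size $p_i\times p_i$. A prime denotes transpose. Tensor elliptical (TE) distribution. Let $\boldsymbol{u}^{(p^* )}$ be uniformly distributed on the unit sphere surface in $\mathbb{R}^{p^*}$, with characteristic function $\boldsymbol{t}\mapsto\Omega_{p^*}(\boldsymbol{t}'\boldsymbol{t})$. A random tensor $\mathcal{X}$ is TE of order $k$, written $\mathcal{X}\sim\mathcal{E}_{\boldsymbol{p}}(\boldsymbol{\mu},\boldsymbol{\Sigma},\psi)$, if $\boldsymbol{x}=\operatorname{vec}(\mathcal{X})=\boldsymbol{\mu}+\mathcal{R}\,\boldsymbol{\Sigma}^{\frac12}\boldsymbol{u}^{(p^* )}$,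 where $\boldsymbol{\mu}\in\mathcal{T}^{\boldsymbol{p}}$, $\boldsymbol{\Sigma}\in\mathcal{T}^{\boldsymbol{p}}_{\otimes}$ is symmetric non-negative definite, $\boldsymbol{\Sigma}^{\frac12}\in\mathcal{T}^{\boldsymbol{p}}_{\otimes}$ is any square root (i.e. $\boldsymbol{\Sigma}^{\frac12}(\boldsymbol{\Sigma}^{\frac12})'=\boldsymbol{\Sigma}$), $\mathcal{R}\ge 0$ is a random variable independent of $\boldsymbol{u}^{(p^* )}$ with cumulative distribution function $F$ on $[0,\infty)$, and $\psi(x)=\int_{\mathbb{R}^+}\Omega_{p^*}(xr^2)\,\mathrm{d}F(r)$. *)

theory Defs
  imports "HOL-Probability.Probability" "Jordan_Normal_Form.Matrix"
begin

(* Keep the names and infix notation for matrices and vectors of Jordan_Normal_Form.Matrix;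
   the homonyms of HOL-Analysis are not used below. *)
unbundle no vec_syntax
no_notation inner (infix "\<bullet>" 70)
hide_const (open) Finite_Cartesian_Product.vec Finite_Cartesian_Product.mat
  Finite_Cartesian_Product.row Finite_Cartesian_Product.transpose

section \<open>Kronecker products and tensors\<close>

definition kron_vec :: "real vec \<Rightarrow> real vec \<Rightarrow> real vec" where
  "kron_vec v w = vec (dim_vec v * dim_vec w)
     (\<lambda>i. v $ (i div dim_vec w) * w $ (i mod dim_vec w))"

definition kron_mat :: "real mat \<Rightarrow> real mat \<Rightarrow> real mat" where
  "kron_mat A B = mat (dim_row A * dim_row B) (dim_col A * dim_col B)
     (\<lambda>(i, j). A $$ (i div dim_row B, j div dim_col B) * B $$ (i mod dim_row B, j mod dim_col B))"

definition kron_vec_list :: "real vec list \<Rightarrow> real vec" where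
  "kron_vec_list vs = foldr kron_vec vs (vec 1 (\<lambda>_. 1))"

definition kron_mat_list :: "real mat list \<Rightarrow> real mat" where
  "kron_mat_list As = foldr kron_mat As (1\<^sub>m 1)"

(* Indices are 0-based: the j-th entry of a multi-index ranges over 0, ..., p ! j - 1. *)
definition multi_indices :: "nat list \<Rightarrow> nat list set" where
  "multi_indices p = {is. list_all2 (<) is p}"

(* A tensor with dimensions p is a function on multi-indices, of which only the values on
   multi_indices p matter. *)
definition tensor_vec :: "nat list \<Rightarrow> (nat list \<Rightarrow> real) \<Rightarrow> real vec" where
  "tensor_vec p X = finsum_vec TYPE(real) (prod_list p)
     (\<lambda>is. X is \<cdot>\<^sub>v kron_vec_list (map2 unit_vec p is)) (multi_indices p)"

definition tensor_space :: "nat list \<Rightarrow> real vec set" where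
  "tensor_space p = range (tensor_vec p)"

definition tensor_mats :: "nat list \<Rightarrow> real mat set" where
  "tensor_mats p = {kron_mat_list As | As. list_all2 (\<lambda>A q. A \<in> carrier_mat q q) As p}"

definition sym_nonneg_definite :: "real mat \<Rightarrow> bool" where
  "sym_nonneg_definite A \<longleftrightarrow> transpose_mat A = A \<and>
     (\<forall>v \<in> carrier_vec (dim_row A). 0 \<le> v \<bullet> (A *\<^sub>v v))"

section \<open>The uniform distribution on the unit sphere\<close>

(* The Borel sigma-algebra on vectors of dimension n, pulled back along the coordinates. *)
definition borel_vec :: "nat \<Rightarrow> real vec measure" where
  "borel_vec n = vimage_algebra (carrier_vec n) (\<lambda>v. \<lambda>i\<in>{..<n}. v $ i) (\<Pi>\<^sub>M i\<in>{..<n}. borel)"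

definition lborel_vec :: "nat \<Rightarrow> real vec measure" where
  "lborel_vec n = distr (\<Pi>\<^sub>M i\<in>{..<n}. lborel) (borel_vec n) (vec n)"

definition vec_norm2 :: "real vec \<Rightarrow> real" where
  "vec_norm2 v = sqrt (v \<bullet> v)"

(* Normalized surface measure: the measure of a Borel set A of unit vectors is the Lebesgue
   measure of the cone of all r * a with 0 < r <= 1 and a in A, divided by the Lebesgue measure
   of the unit ball. Equivalently, the image of the uniform distribution on the unit ball under
   v |-> v / |v|; for n > 0 the origin, mapped to itself, is a null set. *)
definition sphere_uniform :: "nat \<Rightarrow> real vec measure" where
  "sphere_uniform n = distr
     (uniform_measure (lborel_vec n) {v \<in> carrier_vec n. vec_norm2 v \<le> 1})
     (borel_vec n) (\<lambda>v. (1 / vec_norm2 v) \<cdot>\<^sub>v v)"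

definition sphere_char :: "nat \<Rightarrow> real vec \<Rightarrow> complex" where
  "sphere_char n t = (\<integral>u. iexp (t \<bullet> u) \<partial>sphere_uniform n)"

(* The function Omega_n with sphere_char n t = Omega_n (t' t). For n > 0 it is uniquely
   determined on the nonnegative reals; its values at negative arguments are never used. *)
definition Omega :: "nat \<Rightarrow> real \<Rightarrow> complex" where
  "Omega n = (SOME f. \<forall>t \<in> carrier_vec n. sphere_char n t = f (t \<bullet> t))"

section \<open>Tensor elliptical distributions\<close>

(* interval_measure F is the Lebesgue-Stieltjes measure dF; an atom of F at 0 is included. *)
definition elliptical_generator :: "nat \<Rightarrow> (real \<Rightarrow> real) \<Rightarrow> real \<Rightarrow> complex" where
  "elliptical_generator n F x = (LINT r:{0..}|interval_measure F. Omega n (x * r\<^sup>2))"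

(* R and u take values in different types, so their independence is stated as that of the
   sigma-algebras they generate. A is any square root of Sigma that is a Kronecker product;
   psi is only constrained where it is defined, on the nonnegative reals. *)
definition tensor_elliptical ::
  "'a measure \<Rightarrow> nat list \<Rightarrow> ('a \<Rightarrow> nat list \<Rightarrow> real) \<Rightarrow>
    real vec \<Rightarrow> real mat \<Rightarrow> (real \<Rightarrow> complex) \<Rightarrow> bool" where
  "tensor_elliptical M p X \<mu> \<Sigma> \<psi> \<longleftrightarrow>
     (\<forall>is \<in> multi_indices p. (\<lambda>\<omega>. X \<omega> is) \<in> borel_measurable M) \<and>
     \<mu> \<in> tensor_space p \<and> \<Sigma> \<in> tensor_mats p \<and> sym_nonneg_definite \<Sigma> \<and>
     (\<exists>A R u F.
        A \<in> tensor_mats p \<and> A * transpose_mat A = \<Sigma> \<and>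
        R \<in> borel_measurable M \<and> (\<forall>\<omega> \<in> space M. 0 \<le> R \<omega>) \<and>
        F = cdf (distr M borel R) \<and>
        u \<in> measurable M (borel_vec (prod_list p)) \<and>
        distr M (borel_vec (prod_list p)) u = sphere_uniform (prod_list p) \<and>
        prob_space.indep_set M
          {R -` B \<inter> space M | B. B \<in> sets borel}
          {u -` C \<inter> space M | C. C \<in> sets (borel_vec (prod_list p))} \<and>
        (AE \<omega> in M. tensor_vec p (X \<omega>) = \<mu> + R \<omega> \<cdot>\<^sub>v (A *\<^sub>v u \<omega>)) \<and>
        (\<forall>x\<ge>0. \<psi> x = elliptical_generator (prod_list p) F x))"

definition tensor_char ::
  "'a measure \<Rightarrow> nat list \<Rightarrow> ('a \<Rightarrow> nat list \<Rightarrow> real) \<Rightarrow> real vec \<Rightarrow> complex" where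
  "tensor_char M p X S = (\<integral>\<omega>. iexp (S \<bullet> tensor_vec p (X \<omega>)) \<partial>M)"

end

theory Submission
  imports Defs
begin

text \<open>
  The characteristic function of the uniform distribution on the sphere is radial: two vectors
  \<open>t \<noteq> s\<close> of equal length are exchanged by the reflection in the hyperplane orthogonal to
  \<open>t - s\<close>, which preserves Lebesgue measure and lengths, hence the uniform distribution.
  Reflections preserve Lebesgue measure by Tonelli's theorem: once some coordinate \<open>x\<^sub>j\<close> with
  \<open>w\<^sub>j \<noteq> 0\<close> is replaced by \<open>y = w \<bullet> x\<close>, the reflection along \<open>w\<close> becomes \<open>y \<mapsto> - y\<close> together with a
  translation of the other coordinates that depends on \<open>y\<close> only. Given this, writing
  \<open>v = A\<^sup>T S\<close> and conditioning on the independent radius,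
  \<open>E (exp (i R (v \<bullet> u))) = \<integral> \<Omega> (r\<^sup>2 (v \<bullet> v)) dF(r)\<close>, where \<open>v \<bullet> v = S \<bullet> \<Sigma> S\<close>.
\<close>

section \<open>Reflections preserve Lebesgue measure\<close>

interpretation lborel_product: product_sigma_finite "\<lambda>_::nat. lborel::real measure"
  by standard

text \<open>Boxes determine the product measure, and on a box the claim reduces to translation
  invariance of one-dimensional Lebesgue measure in each factor.\<close>

lemma nn_integral_PiM_lborel_translate:
  fixes c :: "nat \<Rightarrow> real"
  assumes J: "finite J" and f: "f \<in> borel_measurable (\<Pi>\<^sub>M i\<in>J. lborel)"
  shows "(\<integral>\<^sup>+x. f (\<lambda>i\<in>J. x i + c i) \<partial>(\<Pi>\<^sub>M i\<in>J. lborel)) = (\<integral>\<^sup>+x. f x \<partial>(\<Pi>\<^sub>M i\<in>J. lborel))"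
proof -
  let ?P = "\<Pi>\<^sub>M i\<in>J. lborel :: real measure" and ?T = "\<lambda>x. \<lambda>i\<in>J. x i + c i"
  have T[measurable]: "?T \<in> measurable ?P ?P"
    by (rule measurable_restrict) measurable
  have "distr ?P ?P ?T = ?P"
  proof (rule lborel_product.PiM_eqI[OF J])
    fix A assume A: "\<And>i. i \<in> J \<Longrightarrow> A i \<in> sets (lborel :: real measure)"
    then have A': "A i \<in> sets borel" if "i \<in> J" for i using that by simp
    have meas: "(\<lambda>s. s + c i) -` A i \<in> sets borel" if "i \<in> J" for i
      using measurable_sets_borel[of "\<lambda>s. s + c i" borel "A i"] A'[OF that] by simp
    have shift: "emeasure lborel ((\<lambda>s. s + c i) -` A i) = emeasure lborel (A i)" if "i \<in> J" for i
    proof -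
      have "emeasure lborel (A i) = emeasure (distr lborel borel ((+) (c i))) (A i)"
        by (simp add: lborel_distr_plus)
      also have "\<dots> = emeasure lborel ((\<lambda>s. s + c i) -` A i)"
        using A'[OF that] by (subst emeasure_distr) (auto simp: add.commute vimage_def)
      finally show ?thesis ..
    qed
    have "?T -` Pi\<^sub>E J A \<inter> space ?P = (\<Pi>\<^sub>E i\<in>J. (\<lambda>s. s + c i) -` A i)"
      by (auto simp: space_PiM PiE_iff)
    moreover have "Pi\<^sub>E J A \<in> sets ?P" using A J by (intro sets_PiM_I_finite) auto
    ultimately have "emeasure (distr ?P ?P ?T) (Pi\<^sub>E J A) = emeasure ?P (\<Pi>\<^sub>E i\<in>J. (\<lambda>s. s + c i) -` A i)"
      by (simp add: emeasure_distr)
    also have "\<dots> = (\<Prod>i\<in>J. emeasure lborel (A i))"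
      using meas J by (subst lborel_product.emeasure_PiM) (auto simp: shift)
    finally show "emeasure (distr ?P ?P ?T) (Pi\<^sub>E J A) = (\<Prod>i\<in>J. emeasure lborel (A i))" .
  qed simp
  then have "(\<integral>\<^sup>+x. f x \<partial>?P) = (\<integral>\<^sup>+x. f x \<partial>distr ?P ?P ?T)" by simp
  also have "\<dots> = (\<integral>\<^sup>+x. f (?T x) \<partial>?P)"
    using f by (intro nn_integral_distr) auto
  finally show ?thesis ..
qed

text \<open>With the other coordinates fixed, the linear form \<open>y\<close> with coefficients
  \<open>w\<close> is affine in coordinate \<open>j\<close> with slope \<open>w j\<close>, whence
  the factor \<open>\<bar>1 / w j\<bar>\<close>. Tonelli then makes \<open>y\<close> the outer
  variable, so that inner transformations may treat it as a constant.\<close>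

lemma nn_integral_PiM_lborel_shear:
  fixes w :: "nat \<Rightarrow> real"
  assumes J: "finite J" "j \<notin> J" and w: "w j \<noteq> 0"
    and f[measurable]: "f \<in> borel_measurable (\<Pi>\<^sub>M i\<in>insert j J. lborel)"
  shows "(\<integral>\<^sup>+x. f x \<partial>(\<Pi>\<^sub>M i\<in>insert j J. lborel)) =
    ennreal \<bar>1 / w j\<bar> *
      (\<integral>\<^sup>+y. \<integral>\<^sup>+x. f (x(j := (y - (\<Sum>i\<in>J. w i * x i)) / w j)) \<partial>(\<Pi>\<^sub>M i\<in>J. lborel) \<partial>lborel)"
proof -
  let ?P = "\<Pi>\<^sub>M i\<in>J. lborel :: real measure" and ?a = "\<lambda>x. \<Sum>i\<in>J. w i * x i"
  interpret P: finite_product_sigma_finite "\<lambda>_. lborel :: real measure" J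
    by standard (rule J)
  \<comment> \<open>Tonelli needs measurability jointly in \<open>x\<close> and \<open>y\<close>;
    the function update is measurable by \<open>measurable_add_dim\<close>.\<close>
  have [measurable]: "(\<lambda>(x, y). f (x(j := (y - ?a x) / w j))) \<in> borel_measurable (?P \<Otimes>\<^sub>M lborel)"
  proof -
    have [measurable]: "(\<lambda>z. \<Sum>i\<in>J. w i * fst z i) \<in> borel_measurable (?P \<Otimes>\<^sub>M (lborel :: real measure))"
      by measurable
    have "(\<lambda>z. (\<lambda>(x, y). x(j := y)) (fst z, (snd z - ?a (fst z)) / w j))
        \<in> measurable (?P \<Otimes>\<^sub>M lborel) (\<Pi>\<^sub>M i\<in>insert j J. lborel)"
      by (rule measurable_compose[OF _ measurable_add_dim]) measurable
    then show ?thesis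
      using measurable_compose[OF _ f] by (simp add: split_beta')
  qed
  have "(\<integral>\<^sup>+x. f x \<partial>(\<Pi>\<^sub>M i\<in>insert j J. lborel)) = (\<integral>\<^sup>+x. \<integral>\<^sup>+y. f (x(j := y)) \<partial>lborel \<partial>?P)"
    using J by (intro lborel_product.product_nn_integral_insert) auto
  also have "\<dots> = (\<integral>\<^sup>+x. ennreal \<bar>1 / w j\<bar> * (\<integral>\<^sup>+y. f (x(j := (y - ?a x) / w j)) \<partial>lborel) \<partial>?P)"
  proof (rule nn_integral_cong)
    fix x assume x: "x \<in> space ?P"
    have "(\<lambda>y. f (x(j := y))) \<in> borel_measurable borel"
      using measurable_compose[OF measurable_fun_upd[of "insert j J" J j "\<lambda>_. x" borel "\<lambda>_. lborel" "\<lambda>y. y"] f] x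
      by simp
    then show "(\<integral>\<^sup>+y. f (x(j := y)) \<partial>lborel) =
        ennreal \<bar>1 / w j\<bar> * (\<integral>\<^sup>+y. f (x(j := (y - ?a x) / w j)) \<partial>lborel)"
      \<comment> \<open>The substitution solves \<open>w j * s + ?a x = y\<close> for the value
        \<open>s\<close> of coordinate \<open>j\<close>.\<close>
      using w by (subst nn_integral_real_affine[where c = "1 / w j" and t = "- ?a x / w j"])
        (auto simp: diff_divide_distrib intro!: arg_cong2[where f = "(*)"] nn_integral_cong)
  qed
  also have "\<dots> = ennreal \<bar>1 / w j\<bar> * (\<integral>\<^sup>+x. \<integral>\<^sup>+y. f (x(j := (y - ?a x) / w j)) \<partial>lborel \<partial>?P)"
    by (rule nn_integral_cmult) measurable
  also have "(\<integral>\<^sup>+x. \<integral>\<^sup>+y. f (x(j := (y - ?a x) / w j)) \<partial>lborel \<partial>?P) =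
      (\<integral>\<^sup>+y. \<integral>\<^sup>+x. f (x(j := (y - ?a x) / w j)) \<partial>?P \<partial>lborel)"
    by (rule pair_sigma_finite.Fubini')
      (auto intro!: pair_sigma_finite.intro P.sigma_finite_measure_axioms lborel.sigma_finite_measure_axioms)
  finally show ?thesis .
qed

lemma nn_integral_PiM_lborel_reflect:
  fixes w :: "nat \<Rightarrow> real"
  assumes I: "finite I" "j \<in> I" and w: "w j \<noteq> 0"
    and f[measurable]: "f \<in> borel_measurable (\<Pi>\<^sub>M i\<in>I. lborel)"
  shows "(\<integral>\<^sup>+x. f (\<lambda>i\<in>I. x i - 2 * (\<Sum>i\<in>I. w i * x i) / (\<Sum>i\<in>I. w i * w i) * w i) \<partial>(\<Pi>\<^sub>M i\<in>I. lborel))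
    = (\<integral>\<^sup>+x. f x \<partial>(\<Pi>\<^sub>M i\<in>I. lborel))"
proof -
  define J where "J = I - {j}"
  have J: "finite J" "j \<notin> J" and IJ: "I = insert j J" using I by (auto simp: J_def)
  let ?P = "\<Pi>\<^sub>M i\<in>J. lborel :: real measure" and ?a = "\<lambda>x. \<Sum>i\<in>J. w i * x i"
  define W where "W = (\<Sum>i\<in>I. w i * w i)"
  have W: "W = w j * w j + (\<Sum>i\<in>J. w i * w i)" using J by (simp add: W_def IJ)
  \<comment> \<open>The single nonzero coefficient \<open>w j\<close> makes the squared length
    positive, so the division by \<open>W\<close> is genuine.\<close>
  have W0: "W > 0" unfolding W using w
    by (intro add_pos_nonneg sum_nonneg) (auto simp: zero_less_mult_iff)
  let ?H = "\<lambda>x. \<lambda>i\<in>I. x i - 2 * (\<Sum>i\<in>I. w i * x i) / W * w i"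
  let ?k = "\<lambda>y x. f (x(j := (y - ?a x) / w j))"
  have [measurable]: "?H \<in> measurable (\<Pi>\<^sub>M i\<in>I. lborel) (\<Pi>\<^sub>M i\<in>I. lborel)"
    by (rule measurable_restrict) measurable
  have f'[measurable]: "f \<in> borel_measurable (\<Pi>\<^sub>M i\<in>insert j J. lborel)" using f by (simp add: IJ)
  have [measurable]: "(\<lambda>(y, x). ?k y x) \<in> borel_measurable (borel \<Otimes>\<^sub>M ?P)"
  proof -
    have [measurable]: "(\<lambda>z. \<Sum>i\<in>J. w i * snd z i) \<in> borel_measurable ((borel :: real measure) \<Otimes>\<^sub>M ?P)"
      by measurable
    have "(\<lambda>z. (\<lambda>(x, y). x(j := y)) (snd z, (fst z - ?a (snd z)) / w j))
        \<in> measurable (borel \<Otimes>\<^sub>M ?P) (\<Pi>\<^sub>M i\<in>insert j J. lborel)"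
      by (rule measurable_compose[OF _ measurable_add_dim]) measurable
    then show ?thesis
      using measurable_compose[OF _ f'] by (simp add: split_beta')
  qed
  have "(\<integral>\<^sup>+x. f (?H x) \<partial>(\<Pi>\<^sub>M i\<in>I. lborel)) =
      ennreal \<bar>1 / w j\<bar> * (\<integral>\<^sup>+y. \<integral>\<^sup>+x. f (?H (x(j := (y - ?a x) / w j))) \<partial>?P \<partial>lborel)"
    unfolding IJ by (rule nn_integral_PiM_lborel_shear[where f = "\<lambda>x. f (?H x)", unfolded IJ]) 
      (use J w in \<open>auto simp: IJ[symmetric]\<close>)
  also have "(\<integral>\<^sup>+y. \<integral>\<^sup>+x. f (?H (x(j := (y - ?a x) / w j))) \<partial>?P \<partial>lborel) =
      (\<integral>\<^sup>+y. \<integral>\<^sup>+x. ?k (- y) (\<lambda>i\<in>J. x i + (- 2 * y / W * w i)) \<partial>?P \<partial>lborel)"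
  proof (intro nn_integral_cong arg_cong[where f = f])
    fix y x assume x: "x \<in> space ?P"
    let ?z = "x(j := (y - ?a x) / w j)" and ?x = "\<lambda>i\<in>J. x i + (- 2 * y / W * w i)"
    have "(\<Sum>i\<in>I. w i * ?z i) = w j * ((y - ?a x) / w j) + (\<Sum>i\<in>J. w i * ?z i)"
      using J by (simp add: IJ)
    also have "(\<Sum>i\<in>J. w i * ?z i) = ?a x" using J by (intro sum.cong) auto
    finally have y: "(\<Sum>i\<in>I. w i * ?z i) = y" using w by simp
    \<comment> \<open>The shift changes the partial form \<open>?a\<close> by
      \<open>- 2 * y / W\<close> times \<open>W - w j * w j\<close>. With this correction, the
      coordinate \<open>j\<close> recomputed from the value \<open>- y\<close> of the full form is
      the reflected one.\<close>
    have "?a ?x = (\<Sum>i\<in>J. w i * x i + (- 2 * y / W) * (w i * w i))"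
      by (intro sum.cong) (auto simp: algebra_simps)
    also have "\<dots> = ?a x + (- 2 * y / W) * (\<Sum>i\<in>J. w i * w i)"
      by (simp only: sum.distrib sum_distrib_left)
    also have "(\<Sum>i\<in>J. w i * w i) = W - w j * w j" by (simp add: W)
    finally have a: "?a ?x = ?a x - 2 * y + 2 * y / W * (w j * w j)"
      using W0 by (simp add: field_simps)
    show "?H ?z = ?x(j := (- y - ?a ?x) / w j)"
    proof
      fix i
      consider "i = j" | "i \<in> J" "i \<noteq> j" | "i \<notin> I" using IJ J by auto
      then show "?H ?z i = (?x(j := (- y - ?a ?x) / w j)) i"
      proof cases
        case 1
        then show ?thesis unfolding a y using w I W0 by (simp add: field_simps)
      next
        case 2
        then show ?thesis unfolding y by (simp add: IJ)
      next
        \<comment> \<open>Outside \<open>I\<close> both sides are the value \<open>undefined\<close>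
          given by \<open>restrict\<close>.\<close>
        case 3
        then show ?thesis unfolding y by (simp add: IJ)
      qed
    qed
  qed
  \<comment> \<open>For fixed \<open>y\<close> the shift is a constant vector, which translation
    invariance removes; what remains is the sign change of \<open>y\<close>.\<close>
  also have "\<dots> = (\<integral>\<^sup>+y. \<integral>\<^sup>+x. ?k (- y) x \<partial>?P \<partial>lborel)"
    by (intro nn_integral_cong nn_integral_PiM_lborel_translate J) measurable
  also have "\<dots> = (\<integral>\<^sup>+y. \<integral>\<^sup>+x. ?k y x \<partial>?P \<partial>lborel)"
  proof -
    interpret P: finite_product_sigma_finite "\<lambda>_. lborel :: real measure" J
      by standard (rule J)
    have "(\<lambda>y. \<integral>\<^sup>+x. ?k y x \<partial>?P) \<in> borel_measurable borel" by measurable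
    from nn_integral_real_affine[OF this, of "-1" 0] show ?thesis by simp
  qed
  also have "ennreal \<bar>1 / w j\<bar> * \<dots> = (\<integral>\<^sup>+x. f x \<partial>(\<Pi>\<^sub>M i\<in>I. lborel))"
    unfolding IJ by (rule nn_integral_PiM_lborel_shear[symmetric]) (use J w in auto)
  finally show ?thesis unfolding W_def .
qed

section \<open>The characteristic function of the sphere is radial\<close>

lemma space_borel_vec[simp]: "space (borel_vec n) = carrier_vec n"
  by (simp add: borel_vec_def)

lemma measurable_vec_index[measurable]:
  "i < n \<Longrightarrow> (\<lambda>v. v $ i) \<in> borel_measurable (borel_vec n)"
proof -
  assume i: "i < n"
  have "(\<lambda>v. (\<lambda>i\<in>{..<n}. v $ i) i) \<in> borel_measurable (borel_vec n)"
    unfolding borel_vec_def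
    by (rule measurable_compose[OF measurable_vimage_algebra1 measurable_component_singleton])
      (use i in \<open>auto simp: space_PiM split: if_split_asm\<close>)
  then show ?thesis using i by simp
qed

lemma measurable_borel_vecI:
  assumes "\<And>x. x \<in> space N \<Longrightarrow> g x \<in> carrier_vec n"
    and "\<And>i. i < n \<Longrightarrow> (\<lambda>x. g x $ i) \<in> borel_measurable N"
  shows "g \<in> measurable N (borel_vec n)"
  unfolding borel_vec_def
  by (rule measurable_vimage_algebra2) (use assms in \<open>auto intro!: measurable_restrict\<close>)

lemma measurable_scalar_prod:
  assumes f: "f \<in> measurable N (borel_vec n)" and g: "g \<in> measurable N (borel_vec n)"
  shows "(\<lambda>x. f x \<bullet> g x) \<in> borel_measurable N"
proof -
  have "(\<lambda>x. \<Sum>i\<in>{0..<n}. f x $ i * g x $ i) \<in> borel_measurable N"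
    using measurable_compose[OF f measurable_vec_index] measurable_compose[OF g measurable_vec_index]
    by (intro borel_measurable_sum borel_measurable_times) auto
  \<comment> \<open>\<open>scalar_prod\<close> sums up to the dimension of its second argument,
    which is known to be \<open>n\<close> only on the space of \<open>N\<close>.\<close>
  moreover have "dim_vec (g x) = n" if "x \<in> space N" for x
    using measurable_space[OF g that] by simp
  ultimately show ?thesis
    by (subst measurable_cong) (auto simp: scalar_prod_def)
qed

lemma measurable_smult_vec:
  assumes f: "f \<in> borel_measurable N" and g: "g \<in> measurable N (borel_vec n)"
  shows "(\<lambda>x. f x \<cdot>\<^sub>v g x) \<in> measurable N (borel_vec n)"
proof (rule measurable_borel_vecI)
  have c: "g x \<in> carrier_vec n" if "x \<in> space N" for x
    using measurable_space[OF g that] by simp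
  then show "f x \<cdot>\<^sub>v g x \<in> carrier_vec n" if "x \<in> space N" for x using that by simp
  fix i assume i: "i < n"
  have "(\<lambda>x. f x * g x $ i) \<in> borel_measurable N"
    using f measurable_compose[OF g measurable_vec_index[OF i]] by simp
  also have "?this \<longleftrightarrow> (\<lambda>x. (f x \<cdot>\<^sub>v g x) $ i) \<in> borel_measurable N"
    by (rule measurable_cong) (use c i in fastforce)
  finally show "(\<lambda>x. (f x \<cdot>\<^sub>v g x) $ i) \<in> borel_measurable N" .
qed

lemma measurable_const_vec: "v \<in> carrier_vec n \<Longrightarrow> (\<lambda>_. v) \<in> measurable N (borel_vec n)"
  by (rule measurable_const) simp

lemma measurable_vec_norm2: "vec_norm2 \<in> borel_measurable (borel_vec n)"
  using measurable_scalar_prod[OF measurable_ident_sets[OF refl] measurable_ident_sets[OF refl]]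
  unfolding vec_norm2_def[abs_def] by simp

lemma measurable_vec_of_PiM: "vec n \<in> measurable (\<Pi>\<^sub>M i\<in>{..<n}. lborel) (borel_vec n)"
  by (rule measurable_borel_vecI) auto

section \<open>Algebra of reflections\<close>

text \<open>The Householder reflection in the hyperplane orthogonal to \<open>w\<close>. For
  \<open>w = 0\<close> the quotient is 0 by convention and the map is the identity.\<close>

definition reflect_vec :: "real vec \<Rightarrow> real vec \<Rightarrow> real vec" where
  "reflect_vec w v = v - (2 * (w \<bullet> v) / (w \<bullet> w)) \<cdot>\<^sub>v w"

lemma reflect_vec_carrier[simp]:
  "w \<in> carrier_vec n \<Longrightarrow> v \<in> carrier_vec n \<Longrightarrow> reflect_vec w v \<in> carrier_vec n"
  by (simp add: reflect_vec_def)

lemma measurable_reflect_vec: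
  assumes w: "w \<in> carrier_vec n"
  shows "reflect_vec w \<in> measurable (borel_vec n) (borel_vec n)"
proof (rule measurable_borel_vecI)
  fix i assume i: "i < n"
  have "(\<lambda>v. v $ i - 2 * (w \<bullet> v) / (w \<bullet> w) * w $ i) \<in> borel_measurable (borel_vec n)"
    using measurable_vec_index[OF i] measurable_scalar_prod[OF measurable_const_vec[OF w] measurable_ident_sets[OF refl]]
    by simp
  also have "?this \<longleftrightarrow> (\<lambda>v. reflect_vec w v $ i) \<in> borel_measurable (borel_vec n)"
    by (rule measurable_cong) (use w i in \<open>auto simp: reflect_vec_def\<close>)
  finally show "(\<lambda>v. reflect_vec w v $ i) \<in> borel_measurable (borel_vec n)" .
qed (use w in simp)

lemma real_scalar_prod_self_eq_0:
  fixes w :: "real vec"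
  assumes "w \<in> carrier_vec n"
  shows "w \<bullet> w = 0 \<longleftrightarrow> w = 0\<^sub>v n"
proof
  assume "w \<bullet> w = 0"
  then have "\<forall>i\<in>{0..<n}. w $ i * w $ i = 0"
    using assms by (subst sum_nonneg_eq_0_iff[symmetric]) (auto simp: scalar_prod_def)
  then show "w = 0\<^sub>v n" using assms by (intro eq_vecI) auto
qed (use assms in simp)

text \<open>A reflection is a symmetric operator. This lets it pass from the integration variable to
  the argument of the characteristic function.\<close>

lemma scalar_prod_reflect_vec:
  assumes "w \<in> carrier_vec n" "v \<in> carrier_vec n" "t \<in> carrier_vec n"
  shows "t \<bullet> reflect_vec w v = reflect_vec w t \<bullet> v"
proof -
  have "t \<bullet> reflect_vec w v = t \<bullet> v - 2 * (w \<bullet> v) / (w \<bullet> w) * (t \<bullet> w)"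
    using assms by (simp add: reflect_vec_def scalar_prod_minus_distrib[of _ n])
  also have "\<dots> = t \<bullet> v - 2 * (w \<bullet> t) / (w \<bullet> w) * (w \<bullet> v)"
    using comm_scalar_prod[of t n w] assms by simp
  also have "\<dots> = reflect_vec w t \<bullet> v"
    using assms by (simp add: reflect_vec_def minus_scalar_prod_distrib[of _ n])
  finally show ?thesis .
qed

text \<open>The reflection flips the sign of \<open>w \<bullet> v\<close>, so the second correction
  along \<open>w\<close> cancels the first.\<close>

lemma reflect_vec_self_inverse:
  assumes w: "w \<in> carrier_vec n" and w0: "w \<noteq> 0\<^sub>v n" and v: "v \<in> carrier_vec n"
  shows "reflect_vec w (reflect_vec w v) = v"
proof -
  have ww: "w \<bullet> w \<noteq> 0" using real_scalar_prod_self_eq_0[OF w] w0 by simp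
  have "w \<bullet> reflect_vec w v = w \<bullet> v - 2 * (w \<bullet> v) / (w \<bullet> w) * (w \<bullet> w)"
    using w v by (simp add: reflect_vec_def scalar_prod_minus_distrib[of _ n])
  then have *: "w \<bullet> reflect_vec w v = - (w \<bullet> v)" using ww by simp
  show ?thesis
    using w v by (intro eq_vecI) (auto simp: reflect_vec_def[of w "reflect_vec w v"] * , auto simp: reflect_vec_def)
qed

text \<open>A symmetric involution is orthogonal: moving one reflection across the inner product
  composes it with the other.\<close>

lemma vec_norm2_reflect_vec:
  assumes "w \<in> carrier_vec n" "w \<noteq> 0\<^sub>v n" "v \<in> carrier_vec n"
  shows "vec_norm2 (reflect_vec w v) = vec_norm2 v"
  using assms by (simp add: vec_norm2_def scalar_prod_reflect_vec[of w n] reflect_vec_self_inverse)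

lemma reflect_vec_smult:
  assumes "w \<in> carrier_vec n" "v \<in> carrier_vec n"
  shows "reflect_vec w (c \<cdot>\<^sub>v v) = c \<cdot>\<^sub>v reflect_vec w v"
  using assms by (intro eq_vecI) (auto simp: reflect_vec_def algebra_simps)

section \<open>Reflection invariance of Lebesgue measure and of the sphere\<close>

lemma sets_lborel_vec[simp, measurable_cong]: "sets (lborel_vec n) = sets (borel_vec n)"
  by (simp add: lborel_vec_def)

lemma space_lborel_vec[simp]: "space (lborel_vec n) = carrier_vec n"
  by (simp add: lborel_vec_def)

lemma sets_sphere_uniform[simp, measurable_cong]: "sets (sphere_uniform n) = sets (borel_vec n)"
  by (simp add: sphere_uniform_def)

lemma space_sphere_uniform[simp]: "space (sphere_uniform n) = carrier_vec n"
  by (simp add: sphere_uniform_def)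

text \<open>The map \<open>vec n\<close> carries the reflection in coordinates, \<open>?H\<close>,
  to \<open>reflect_vec w\<close>, and \<open>lborel_vec n\<close> is the image of the product
  measure under \<open>vec n\<close>; so the invariance of the product measure is inherited.\<close>

lemma distr_lborel_vec_reflect:
  assumes w: "w \<in> carrier_vec n" and w0: "w \<noteq> 0\<^sub>v n"
  shows "distr (lborel_vec n) (borel_vec n) (reflect_vec w) = lborel_vec n"
proof (rule measure_eqI)
  let ?P = "\<Pi>\<^sub>M i\<in>{..<n}. lborel :: real measure"
  let ?H = "\<lambda>x. \<lambda>i\<in>{..<n}. x i - 2 * (\<Sum>i<n. w $ i * x i) / (\<Sum>i<n. w $ i * w $ i) * w $ i"
  \<comment> \<open>A nonzero coordinate serves as the pivot for the change of variables.\<close>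
  obtain j where j: "j < n" "w $ j \<noteq> 0" using w w0 by (metis eq_vecI carrier_vecD index_zero_vec)
  fix C assume "C \<in> sets (distr (lborel_vec n) (borel_vec n) (reflect_vec w))"
  then have C: "C \<in> sets (borel_vec n)" by simp
  have ind: "indicator C \<in> borel_measurable (borel_vec n)" using C by simp
  have nn: "emeasure (lborel_vec n) D = (\<integral>\<^sup>+x. indicator D (vec n x) \<partial>?P)"
    if D: "D \<in> sets (borel_vec n)" for D
  proof -
    have "emeasure (lborel_vec n) D = (\<integral>\<^sup>+v. indicator D v \<partial>lborel_vec n)"
      using D by simp
    also have "\<dots> = (\<integral>\<^sup>+x. indicator D (vec n x) \<partial>?P)"
      unfolding lborel_vec_def using D by (intro nn_integral_distr measurable_vec_of_PiM) auto
    finally show ?thesis .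
  qed
  have "emeasure (distr (lborel_vec n) (borel_vec n) (reflect_vec w)) C =
      emeasure (lborel_vec n) (reflect_vec w -` C \<inter> space (borel_vec n))"
    using measurable_reflect_vec[OF w] C by (subst emeasure_distr) (auto cong: measurable_cong_sets)
  also have "\<dots> = (\<integral>\<^sup>+x. indicator (reflect_vec w -` C \<inter> space (borel_vec n)) (vec n x) \<partial>?P)"
    by (intro nn measurable_sets[OF measurable_reflect_vec[OF w] C])
  also have "\<dots> = (\<integral>\<^sup>+x. indicator C (vec n (?H x)) \<partial>?P)"
  proof (intro nn_integral_cong)
    fix x
    have "reflect_vec w (vec n x) = vec n (?H x)"
      using w by (intro eq_vecI) (auto simp: reflect_vec_def scalar_prod_def lessThan_atLeast0)
    then show "(indicator (reflect_vec w -` C \<inter> space (borel_vec n)) (vec n x) :: ennreal)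
        = indicator C (vec n (?H x))"
      by (auto simp: indicator_def)
  qed
  also have "\<dots> = (\<integral>\<^sup>+x. indicator C (vec n x) \<partial>?P)"
    by (rule nn_integral_PiM_lborel_reflect[where f = "\<lambda>x. indicator C (vec n x)" and w = "\<lambda>i. w $ i"])
      (use j measurable_compose[OF measurable_vec_of_PiM ind] in auto)
  also have "\<dots> = emeasure (lborel_vec n) C" using nn[OF C] by simp
  finally show "emeasure (distr (lborel_vec n) (borel_vec n) (reflect_vec w)) C = emeasure (lborel_vec n) C" .
qed simp

text \<open>Reflections preserve length and commute with scaling, hence with the normalization
  \<open>?N\<close>. The part of the ball normalized into the preimage of \<open>C\<close> is
  therefore the preimage of the part normalized into \<open>C\<close>, and both have the same
  Lebesgue measure.\<close>

lemma distr_sphere_uniform_reflect: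
  assumes w: "w \<in> carrier_vec n" and w0: "w \<noteq> 0\<^sub>v n"
  shows "distr (sphere_uniform n) (borel_vec n) (reflect_vec w) = sphere_uniform n"
proof (rule measure_eqI)
  let ?B = "{v \<in> carrier_vec n. vec_norm2 v \<le> 1}"
  let ?N = "\<lambda>v::real vec. (1 / vec_norm2 v) \<cdot>\<^sub>v v"
  let ?H = "reflect_vec w"
  have B: "?B \<in> sets (borel_vec n)"
    using borel_measurable_le[OF measurable_vec_norm2 measurable_const, of 1 n] by simp
  have N: "?N \<in> measurable (borel_vec n) (borel_vec n)"
    using measurable_vec_norm2 by (intro measurable_smult_vec measurable_ident_sets[OF refl]) auto
  note H = measurable_reflect_vec[OF w]
  have emeas: "emeasure (sphere_uniform n) D =
      emeasure (lborel_vec n) (?B \<inter> (?N -` D \<inter> carrier_vec n)) / emeasure (lborel_vec n) ?B"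
    if D: "D \<in> sets (borel_vec n)" for D
  proof -
    have "emeasure (sphere_uniform n) D = emeasure (uniform_measure (lborel_vec n) ?B) (?N -` D \<inter> carrier_vec n)"
      unfolding sphere_uniform_def using N D
      by (subst emeasure_distr) (auto cong: measurable_cong_sets)
    then show ?thesis using B measurable_sets[OF N D] by simp
  qed
  fix C assume "C \<in> sets (distr (sphere_uniform n) (borel_vec n) ?H)"
  then have C: "C \<in> sets (borel_vec n)" by simp
  have HC: "?H -` C \<inter> carrier_vec n \<in> sets (borel_vec n)" using measurable_sets[OF H C] by simp
  have BC: "?B \<inter> (?N -` C \<inter> carrier_vec n) \<in> sets (borel_vec n)"
    using B measurable_sets[OF N C] by simp
  have "emeasure (distr (sphere_uniform n) (borel_vec n) ?H) C =
      emeasure (sphere_uniform n) (?H -` C \<inter> carrier_vec n)"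
    using H C by (subst emeasure_distr) (auto cong: measurable_cong_sets)
  also have "\<dots> = emeasure (lborel_vec n) (?B \<inter> (?N -` (?H -` C \<inter> carrier_vec n) \<inter> carrier_vec n))
      / emeasure (lborel_vec n) ?B"
    by (rule emeas[OF HC])
  also have "?B \<inter> (?N -` (?H -` C \<inter> carrier_vec n) \<inter> carrier_vec n) =
      ?H -` (?B \<inter> (?N -` C \<inter> carrier_vec n)) \<inter> carrier_vec n"
    using w w0 by (auto simp: vec_norm2_reflect_vec reflect_vec_smult)
  also have "emeasure (lborel_vec n) \<dots> =
      emeasure (distr (lborel_vec n) (borel_vec n) ?H) (?B \<inter> (?N -` C \<inter> carrier_vec n))"
    using H BC by (subst emeasure_distr) (auto cong: measurable_cong_sets)
  also have "\<dots> = emeasure (lborel_vec n) (?B \<inter> (?N -` C \<inter> carrier_vec n))"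
    by (simp add: distr_lborel_vec_reflect[OF w w0])
  also have "\<dots> / emeasure (lborel_vec n) ?B = emeasure (sphere_uniform n) C"
    by (rule emeas[OF C, symmetric])
  finally show "emeasure (distr (sphere_uniform n) (borel_vec n) ?H) C = emeasure (sphere_uniform n) C" .
qed simp

section \<open>From reflection invariance to the function \<open>Omega\<close>\<close>

lemma measurable_iexp_scalar_prod:
  "t \<in> carrier_vec n \<Longrightarrow> (\<lambda>u. iexp (t \<bullet> u)) \<in> borel_measurable (borel_vec n)"
  using measurable_scalar_prod[OF measurable_const_vec measurable_ident_sets[OF refl], of t n]
  by (intro measurable_compose[of "\<lambda>u. t \<bullet> u" _ borel iexp]) simp_all

text \<open>Change variables by the reflection, which leaves the measure fixed, and move it to
  \<open>t\<close> by symmetry.\<close>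

lemma sphere_char_reflect:
  assumes w: "w \<in> carrier_vec n" and w0: "w \<noteq> 0\<^sub>v n" and t: "t \<in> carrier_vec n"
  shows "sphere_char n (reflect_vec w t) = sphere_char n t"
proof -
  have "sphere_char n t = (\<integral>u. iexp (t \<bullet> u) \<partial>distr (sphere_uniform n) (borel_vec n) (reflect_vec w))"
    by (simp add: sphere_char_def distr_sphere_uniform_reflect[OF w w0])
  also have "\<dots> = (\<integral>u. iexp (t \<bullet> reflect_vec w u) \<partial>sphere_uniform n)"
    using measurable_reflect_vec[OF w] measurable_iexp_scalar_prod[OF t]
    by (intro integral_distr) (auto cong: measurable_cong_sets)
  also have "\<dots> = sphere_char n (reflect_vec w t)"
    unfolding sphere_char_def using w t
    by (intro Bochner_Integration.integral_cong) (auto simp: scalar_prod_reflect_vec[of w n])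
  finally show ?thesis ..
qed

lemma minus_vec_eq_0_iff:
  fixes t s :: "real vec"
  assumes t: "t \<in> carrier_vec n" and s: "s \<in> carrier_vec n"
  shows "t - s = 0\<^sub>v n \<longleftrightarrow> t = s"
proof
  assume *: "t - s = 0\<^sub>v n"
  have "t $ i = s $ i" if "i < n" for i
    using arg_cong[OF *, of "\<lambda>v. v $ i"] that t s by simp
  then show "t = s" using t s by (intro eq_vecI) auto
qed (use t in simp)

text \<open>Equal lengths give \<open>(t - s) \<bullet> (t - s) = 2 * ((t - s) \<bullet> t)\<close>,
  so the coefficient in the reflection is 1 and exactly \<open>t - s\<close> is subtracted.\<close>

lemma reflect_vec_diff:
  assumes t: "t \<in> carrier_vec n" and s: "s \<in> carrier_vec n"
    and eq: "t \<bullet> t = s \<bullet> s" and ne: "t \<noteq> s"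
  shows "reflect_vec (t - s) t = s"
proof -
  have ww: "(t - s) \<bullet> (t - s) \<noteq> 0"
    using real_scalar_prod_self_eq_0[of "t - s" n] minus_vec_eq_0_iff[OF t s] t s ne by simp
  have "(t - s) \<bullet> (t - s) = 2 * ((t - s) \<bullet> t)"
    using t s eq comm_scalar_prod[of t n s]
    by (simp add: minus_scalar_prod_distrib[of _ n] scalar_prod_minus_distrib[of _ n])
  then have "2 * ((t - s) \<bullet> t) / ((t - s) \<bullet> (t - s)) = 1" using ww by simp
  then show ?thesis using t s by (intro eq_vecI) (auto simp: reflect_vec_def)
qed

text \<open>\<open>Omega n\<close> is a Hilbert choice, so its defining property holds as soon as
  some function satisfies it; radial symmetry provides one.\<close>

lemma sphere_char_eq_Omega:
  assumes t: "t \<in> carrier_vec n"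
  shows "sphere_char n t = Omega n (t \<bullet> t)"
proof -
  have radial: "sphere_char n t = sphere_char n s"
    if t: "t \<in> carrier_vec n" and s: "s \<in> carrier_vec n" and eq: "t \<bullet> t = s \<bullet> s" for t s
  proof (cases "t = s")
    case False
    have "t - s \<noteq> 0\<^sub>v n"
      using False minus_vec_eq_0_iff[OF t s] by simp
    then show ?thesis
      using sphere_char_reflect[of "t - s" n t] reflect_vec_diff[OF t s eq False] t s by simp
  qed simp
  \<comment> \<open>The witness evaluates the characteristic function at an arbitrary vector of
    squared length \<open>x\<close>; by \<open>radial\<close> the choice of that vector does not
    matter.\<close>
  let ?f = "\<lambda>x. sphere_char n (SOME s. s \<in> carrier_vec n \<and> s \<bullet> s = x)"
  have "\<forall>t \<in> carrier_vec n. sphere_char n t = ?f (t \<bullet> t)"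
  proof
    fix t :: "real vec" assume t: "t \<in> carrier_vec n"
    then have "(SOME s. s \<in> carrier_vec n \<and> s \<bullet> s = t \<bullet> t) \<in> carrier_vec n \<and>
        (SOME s. s \<in> carrier_vec n \<and> s \<bullet> s = t \<bullet> t) \<bullet> (SOME s. s \<in> carrier_vec n \<and> s \<bullet> s = t \<bullet> t) = t \<bullet> t"
      by (intro someI[of "\<lambda>s. s \<in> carrier_vec n \<and> s \<bullet> s = t \<bullet> t"]) simp
    then show "sphere_char n t = ?f (t \<bullet> t)" using t by (intro radial) auto
  qed
  then have "\<forall>t \<in> carrier_vec n. sphere_char n t = Omega n (t \<bullet> t)"
    unfolding Omega_def by (rule someI[of "\<lambda>f. \<forall>t \<in> carrier_vec n. sphere_char n t = f (t \<bullet> t)"])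
  with t show ?thesis by blast
qed

section \<open>Tensor elliptical distributions\<close>

text \<open>Independence of the generated sigma-algebras gives the product formula on rectangles,
  and rectangles determine the product measure. The two variables may have different value
  types.\<close>

lemma (in prob_space) distr_pair_of_indep_set:
  assumes X: "X \<in> measurable M N" and Y: "Y \<in> measurable M L"
    and ind: "indep_set {X -` B \<inter> space M | B. B \<in> sets N} {Y -` C \<inter> space M | C. C \<in> sets L}"
  shows "distr M (N \<Otimes>\<^sub>M L) (\<lambda>\<omega>. (X \<omega>, Y \<omega>)) = distr M N X \<Otimes>\<^sub>M distr M L Y"
proof (rule pair_measure_eqI[symmetric])
  show "sigma_finite_measure (distr M N X)" "sigma_finite_measure (distr M L Y)"
    using X Y by (auto intro!: prob_space_imp_sigma_finite prob_space_distr)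
  show "sets (distr M N X \<Otimes>\<^sub>M distr M L Y) = sets (distr M (N \<Otimes>\<^sub>M L) (\<lambda>\<omega>. (X \<omega>, Y \<omega>)))"
    by simp
  fix B C assume "B \<in> sets (distr M N X)" "C \<in> sets (distr M L Y)"
  then have B: "B \<in> sets N" and C: "C \<in> sets L" by auto
  have "prob ((X -` B \<inter> space M) \<inter> (Y -` C \<inter> space M)) = prob (X -` B \<inter> space M) * prob (Y -` C \<inter> space M)"
    by (rule indep_setD[OF ind]) (use B C in auto)
  moreover have "(\<lambda>\<omega>. (X \<omega>, Y \<omega>)) -` (B \<times> C) \<inter> space M = (X -` B \<inter> space M) \<inter> (Y -` C \<inter> space M)"
    by auto
  ultimately show "emeasure (distr M N X) B * emeasure (distr M L Y) C =
      emeasure (distr M (N \<Otimes>\<^sub>M L) (\<lambda>\<omega>. (X \<omega>, Y \<omega>))) (B \<times> C)"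
    using X Y B C by (simp add: emeasure_distr emeasure_eq_measure ennreal_mult)
qed

text \<open>A law on the reals is determined by its distribution function. This identifies the
  Stieltjes integral in \<open>elliptical_generator\<close> with an integral against the law of the
  radius.\<close>

lemma (in real_distribution) interval_measure_cdf: "interval_measure (cdf M) = M"
proof (rule cdf_unique)
  show "real_distribution (interval_measure (cdf M))"
    by (intro real_distribution_interval_measure cdf_nondecreasing cdf_is_right_cont cdf_lim_at_bot
        cdf_lim_at_top_prob)
  show "cdf (interval_measure (cdf M)) = cdf M"
    by (intro cdf_interval_measure cdf_nondecreasing cdf_is_right_cont cdf_lim_at_bot)
qed (rule real_distribution_axioms)

section \<open>Dimensions and measurability of vectorized tensors\<close>

lemma multi_indices_Cons: "multi_indices (q # p) = (\<lambda>(i, is). i # is) ` ({..<q} \<times> multi_indices p)"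
  by (auto simp: multi_indices_def list_all2_Cons2)

lemma finite_multi_indices: "finite (multi_indices p)"
  by (induction p) (simp_all add: multi_indices_Cons, simp add: multi_indices_def)

lemma kron_vec_list_carrier: "kron_vec_list vs \<in> carrier_vec (prod_list (map dim_vec vs))"
proof (induction vs)
  case (Cons v vs)
  then have "dim_vec (foldr kron_vec vs (vec 1 (\<lambda>_. 1))) = prod_list (map dim_vec vs)"
    unfolding kron_vec_list_def by (rule carrier_vecD)
  then show ?case by (intro carrier_vecI) (simp add: kron_vec_list_def kron_vec_def)
qed (simp add: kron_vec_list_def)

lemma kron_mat_list_carrier:
  "list_all2 (\<lambda>A q. A \<in> carrier_mat q q) As p \<Longrightarrow>
    kron_mat_list As \<in> carrier_mat (prod_list p) (prod_list p)"
proof (induction rule: list_all2_induct)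
  case (Cons A As q p)
  then show ?case by (auto simp: kron_mat_list_def kron_mat_def)
qed (simp add: kron_mat_list_def)

lemma tensor_mats_carrier: "A \<in> tensor_mats p \<Longrightarrow> A \<in> carrier_mat (prod_list p) (prod_list p)"
  by (auto simp: tensor_mats_def kron_mat_list_carrier)

lemma kron_unit_carrier:
  assumes "is \<in> multi_indices p"
  shows "kron_vec_list (map2 unit_vec p is) \<in> carrier_vec (prod_list p)"
proof -
  have "length p = length is" using assms by (auto simp: multi_indices_def list_all2_lengthD)
  then have "map dim_vec (map2 unit_vec p is) = p" by (induction p "is" rule: list_induct2) auto
  then show ?thesis by (metis kron_vec_list_carrier)
qed

lemma tensor_vec_carrier: "tensor_vec p X \<in> carrier_vec (prod_list p)"
  unfolding tensor_vec_def by (intro finsum_vec_closed) (auto intro: kron_unit_carrier)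

text \<open>Each coordinate is a finite linear combination of tensor entries with constant
  coefficients.\<close>

lemma measurable_tensor_vec:
  assumes "\<And>is. is \<in> multi_indices p \<Longrightarrow> (\<lambda>\<omega>. X \<omega> is) \<in> borel_measurable M"
  shows "(\<lambda>\<omega>. tensor_vec p (X \<omega>)) \<in> measurable M (borel_vec (prod_list p))"
proof (rule measurable_borel_vecI)
  fix i assume i: "i < prod_list p"
  have "tensor_vec p (X \<omega>) $ i =
      (\<Sum>is\<in>multi_indices p. X \<omega> is * kron_vec_list (map2 unit_vec p is) $ i)" for \<omega>
  proof -
    have "tensor_vec p (X \<omega>) $ i =
        (\<Sum>is\<in>multi_indices p. (X \<omega> is \<cdot>\<^sub>v kron_vec_list (map2 unit_vec p is)) $ i)"
      unfolding tensor_vec_def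
      by (rule index_finsum_vec) (use i in \<open>auto intro: finite_multi_indices kron_unit_carrier\<close>)
    also have "\<dots> = (\<Sum>is\<in>multi_indices p. X \<omega> is * kron_vec_list (map2 unit_vec p is) $ i)"
      using i by (intro sum.cong refl index_smult_vec) (auto dest: kron_unit_carrier)
    finally show ?thesis .
  qed
  then show "(\<lambda>\<omega>. tensor_vec p (X \<omega>) $ i) \<in> borel_measurable M"
    using assms by simp
qed (rule tensor_vec_carrier)

section \<open>The quadratic form and conditioning on the radius\<close>

lemma scalar_prod_gram:
  fixes A :: "real mat"
  assumes A: "A \<in> carrier_mat n m" and S: "S \<in> carrier_vec n"
  shows "S \<bullet> ((A * transpose_mat A) *\<^sub>v S) = (transpose_mat A *\<^sub>v S) \<bullet> (transpose_mat A *\<^sub>v S)"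
proof -
  have "S \<bullet> ((A * transpose_mat A) *\<^sub>v S) = S \<bullet> (A *\<^sub>v (transpose_mat A *\<^sub>v S))"
    using A S by (subst assoc_mult_mat_vec[of A n m]) auto
  also have "\<dots> = (transpose_mat A *\<^sub>v S) \<bullet> (transpose_mat A *\<^sub>v S)"
    using A S by (intro transpose_vec_mult_scalar[symmetric]) auto
  finally show ?thesis .
qed

lemma measurable_iexp_scaled_scalar_prod:
  assumes v: "v \<in> carrier_vec n"
  shows "(\<lambda>(r, u). iexp (r * (v \<bullet> u))) \<in> borel_measurable (borel \<Otimes>\<^sub>M borel_vec n)"
proof -
  have "(\<lambda>z. v \<bullet> snd z) \<in> borel_measurable ((borel :: real measure) \<Otimes>\<^sub>M borel_vec n)"
    by (intro measurable_scalar_prod[OF measurable_const_vec[OF v] measurable_snd])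
  then have "(\<lambda>z. fst z * (v \<bullet> snd z)) \<in> borel_measurable ((borel :: real measure) \<Otimes>\<^sub>M borel_vec n)"
    by measurable
  from measurable_compose[OF this, of iexp borel] show ?thesis
    by (simp add: split_beta')
qed

text \<open>By independence the joint law of radius and direction is a product, so Fubini applies;
  the inner integral at radius \<open>r\<close> is the sphere's characteristic function at
  \<open>r \<cdot>\<^sub>v v\<close>.\<close>

lemma (in prob_space) char_scaled_sphere:
  assumes R: "R \<in> borel_measurable M" and R0: "\<And>\<omega>. \<omega> \<in> space M \<Longrightarrow> 0 \<le> R \<omega>"
    and u: "u \<in> measurable M (borel_vec n)"
    and unif: "distr M (borel_vec n) u = sphere_uniform n"
    and ind: "indep_set {R -` B \<inter> space M | B. B \<in> sets borel}
      {u -` C \<inter> space M | C. C \<in> sets (borel_vec n)}"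
    and v: "v \<in> carrier_vec n"
  shows "(\<integral>\<omega>. iexp (R \<omega> * (v \<bullet> u \<omega>)) \<partial>M) =
    elliptical_generator n (cdf (distr M borel R)) (v \<bullet> v)"
proof -
  let ?P = "distr M borel R" and ?Q = "sphere_uniform n"
  let ?g = "\<lambda>(r, u). iexp (r * (v \<bullet> u))"
  interpret P: real_distribution ?P by (rule real_distribution_distr[OF R])
  interpret Q: prob_space ?Q unfolding unif[symmetric] by (rule prob_space_distr[OF u])
  interpret PQ: pair_prob_space ?P ?Q ..
  note g = measurable_iexp_scaled_scalar_prod[OF v]
  have g': "?g \<in> borel_measurable (?P \<Otimes>\<^sub>M ?Q)"
    using g by (simp cong: measurable_cong_sets)
  have sphere: "(\<integral>u. iexp (r * (v \<bullet> u)) \<partial>?Q) = Omega n ((v \<bullet> v) * r\<^sup>2)" for r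
  proof -
    have "(\<integral>u. iexp (r * (v \<bullet> u)) \<partial>?Q) = sphere_char n (r \<cdot>\<^sub>v v)"
      unfolding sphere_char_def using v by (intro Bochner_Integration.integral_cong) auto
    also have "\<dots> = Omega n ((r \<cdot>\<^sub>v v) \<bullet> (r \<cdot>\<^sub>v v))"
      using v by (intro sphere_char_eq_Omega) simp
    also have "(r \<cdot>\<^sub>v v) \<bullet> (r \<cdot>\<^sub>v v) = (v \<bullet> v) * r\<^sup>2"
      using v by (simp add: power2_eq_square)
    finally show ?thesis .
  qed
  \<comment> \<open>The choice defining \<open>Omega\<close> says nothing about measurability; here
    it follows because the function is an integral depending on the parameter
    \<open>r\<close>.\<close>
  have Om: "(\<lambda>r. Omega n ((v \<bullet> v) * r\<^sup>2)) \<in> borel_measurable ?P"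
    using Q.borel_measurable_lebesgue_integral[OF g'] unfolding sphere .
  have "(\<integral>\<omega>. iexp (R \<omega> * (v \<bullet> u \<omega>)) \<partial>M) = (\<integral>z. ?g z \<partial>distr M (borel \<Otimes>\<^sub>M borel_vec n) (\<lambda>\<omega>. (R \<omega>, u \<omega>)))"
    using R u g by (subst integral_distr) auto
  also have "\<dots> = (\<integral>z. ?g z \<partial>(?P \<Otimes>\<^sub>M ?Q))"
    by (simp add: distr_pair_of_indep_set[OF R u ind] unif)
  also have "\<dots> = (\<integral>r. \<integral>u. ?g (r, u) \<partial>?Q \<partial>?P)"
    \<comment> \<open>The integrand has modulus 1, hence is integrable for a probability
      measure.\<close>
    by (intro PQ.integral_fst'[symmetric] PQ.integrable_const_bound[where B = 1] g') auto
  also have "\<dots> = (\<integral>r. Omega n ((v \<bullet> v) * r\<^sup>2) \<partial>?P)"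
    by (simp only: sphere case_prod_conv)
  also have "\<dots> = (LINT r:{0..}|?P. Omega n ((v \<bullet> v) * r\<^sup>2))"
  proof -
    \<comment> \<open>The radius is nonnegative, so restricting the integral to \<open>{0..}\<close>
      changes nothing.\<close>
    have "AE r in ?P. 0 \<le> r" using R R0 by (subst AE_distr_iff) auto
    then show ?thesis
      unfolding set_lebesgue_integral_def using Om
      by (intro integral_cong_AE borel_measurable_scaleR) (auto simp: indicator_def)
  qed
  also have "\<dots> = elliptical_generator n (cdf ?P) (v \<bullet> v)"
    by (simp add: elliptical_generator_def P.interval_measure_cdf)
  finally show ?thesis .
qed

theorem theorem3:
  fixes M :: "'a measure" and p :: "nat list" and X :: "'a \<Rightarrow> nat list \<Rightarrow> real"
    and \<mu> :: "real vec" and \<Sigma> :: "real mat" and \<psi> :: "real \<Rightarrow> complex" and S :: "real vec"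
  assumes "prob_space M"
    and "\<forall>q \<in> set p. 0 < q"
    and "tensor_elliptical M p X \<mu> \<Sigma> \<psi>"
    and "S \<in> tensor_space p"
  shows "tensor_char M p X S = iexp (S \<bullet> \<mu>) * \<psi> (S \<bullet> (\<Sigma> *\<^sub>v S))"
proof -
  interpret prob_space M by fact
  let ?n = "prod_list p"
  from assms(3) obtain A R u where X: "\<forall>is \<in> multi_indices p. (\<lambda>\<omega>. X \<omega> is) \<in> borel_measurable M"
    and \<mu>: "\<mu> \<in> tensor_space p"
    and A: "A \<in> tensor_mats p" "A * transpose_mat A = \<Sigma>"
    and R: "R \<in> borel_measurable M" "\<forall>\<omega> \<in> space M. 0 \<le> R \<omega>"
    and u: "u \<in> measurable M (borel_vec ?n)" "distr M (borel_vec ?n) u = sphere_uniform ?n"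
    and ind: "indep_set {R -` B \<inter> space M | B. B \<in> sets borel}
      {u -` C \<inter> space M | C. C \<in> sets (borel_vec ?n)}"
    and rep: "AE \<omega> in M. tensor_vec p (X \<omega>) = \<mu> + R \<omega> \<cdot>\<^sub>v (A *\<^sub>v u \<omega>)"
    and \<psi>: "\<forall>x\<ge>0. \<psi> x = elliptical_generator ?n (cdf (distr M borel R)) x"
    unfolding tensor_elliptical_def by blast
  have S: "S \<in> carrier_vec ?n" and \<mu>c: "\<mu> \<in> carrier_vec ?n"
    using assms(4) \<mu> tensor_vec_carrier by (auto simp: tensor_space_def)
  have Ac: "A \<in> carrier_mat ?n ?n" using A(1) by (rule tensor_mats_carrier)
  define v where "v = transpose_mat A *\<^sub>v S"
  have v: "v \<in> carrier_vec ?n" using Ac S by (simp add: v_def)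
  have vv: "S \<bullet> (\<Sigma> *\<^sub>v S) = v \<bullet> v"
    unfolding v_def A(2)[symmetric] by (rule scalar_prod_gram[OF Ac S])
  \<comment> \<open>\<open>\<psi>\<close> is tied to the generator on nonnegative arguments
    only.\<close>
  have v0: "0 \<le> v \<bullet> v" by (simp add: scalar_prod_def sum_nonneg)
  have meas: "(\<lambda>\<omega>. iexp (R \<omega> * (v \<bullet> u \<omega>))) \<in> borel_measurable M"
    using measurable_compose[OF measurable_Pair[OF R(1) u(1)] measurable_iexp_scaled_scalar_prod[OF v]]
    by simp
  have "tensor_char M p X S = (\<integral>\<omega>. iexp (S \<bullet> \<mu>) * iexp (R \<omega> * (v \<bullet> u \<omega>)) \<partial>M)"
    unfolding tensor_char_def
  \<comment> \<open>The stochastic representation holds almost everywhere only, so both integrands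
    have to be shown measurable.\<close>
  proof (rule integral_cong_AE)
    show "(\<lambda>\<omega>. iexp (S \<bullet> tensor_vec p (X \<omega>))) \<in> borel_measurable M"
      using measurable_compose[OF measurable_tensor_vec measurable_iexp_scalar_prod[OF S]] X by blast
    show "(\<lambda>\<omega>. iexp (S \<bullet> \<mu>) * iexp (R \<omega> * (v \<bullet> u \<omega>))) \<in> borel_measurable M"
      using meas by (intro borel_measurable_times) auto
    show "AE \<omega> in M. iexp (S \<bullet> tensor_vec p (X \<omega>)) = iexp (S \<bullet> \<mu>) * iexp (R \<omega> * (v \<bullet> u \<omega>))"
      using rep AE_space
    proof eventually_elim
      case (elim \<omega>)
      have uc: "u \<omega> \<in> carrier_vec ?n" using measurable_space[OF u(1) elim(2)] by simp
      \<comment> \<open>Moving \<open>A\<close> across the inner product is what motivates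
        \<open>v\<close>.\<close>
      have "S \<bullet> (A *\<^sub>v u \<omega>) = v \<bullet> u \<omega>"
        unfolding v_def by (rule transpose_vec_mult_scalar[OF Ac uc S, symmetric])
      then have "S \<bullet> tensor_vec p (X \<omega>) = S \<bullet> \<mu> + R \<omega> * (v \<bullet> u \<omega>)"
        using S \<mu>c Ac uc by (simp add: elim(1) scalar_prod_add_distrib[of _ ?n])
      then show ?case by (simp add: exp_add[symmetric] distrib_left)
    qed
  qed
  also have "\<dots> = iexp (S \<bullet> \<mu>) * (\<integral>\<omega>. iexp (R \<omega> * (v \<bullet> u \<omega>)) \<partial>M)"
    by simp
  also have "(\<integral>\<omega>. iexp (R \<omega> * (v \<bullet> u \<omega>)) \<partial>M) = elliptical_generator ?n (cdf (distr M borel R)) (v \<bullet> v)"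
    using R u ind v by (intro char_scaled_sphere) auto
  also have "\<dots> = \<psi> (S \<bullet> (\<Sigma> *\<^sub>v S))" using \<psi> v0 vv by simp
  finally show ?thesis .
qed

end
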